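(* Let $\mathcal C$ be a category and let $J$ and $I$ be collections of morphisms of $\mathcal C$. Suppose $I$ is wellfounded and $(J,I)$ has the shift property. Then the $(J,I)$-seed order on the objects of $\mathcal C$ is wellfounded (there is no sequence of objects $u_0>u_1>u_2>\cdots$).
   Context: $I$ is wellfounded if there is no sequence $\langle i_n:n<\omega\rangle$ of elements of $I$ with $\mathrm{cod}(i_n)=\mathrm{dom}(i_{n+1})$ for all $n$. $(J,I)$ has the shift property if for every $j:v\to w$ in $J$ and every $i:v\to u$ in $I$ there is an object $x$ with morphisms $i':w\to x$ in $I$ and $j':u\to x$ in $J$. The $(J,I)$-seed order is defined on objects by $u<w$ iff there is an object $x$ with morphisms $j:u\to x$ in $J$ and $i:w\to x$ in $I$. *)

theory Defs
  imports Main
begin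

record ('o, 'm) category_data =
  Ob :: "'o set"
  Mor :: "'m set"
  Dom :: "'m \<Rightarrow> 'o"
  Cod :: "'m \<Rightarrow> 'o"
  Ident :: "'o \<Rightarrow> 'm"
  Comp :: "'m \<Rightarrow> 'm \<Rightarrow> 'm"

text \<open>\<open>Comp C g f\<close> is the composite \<open>g \<circ> f\<close>, first \<open>f\<close> and then \<open>g\<close>; it is meaningful
  only when \<open>Cod C f = Dom C g\<close>.\<close>

definition arrow :: "('o, 'm) category_data \<Rightarrow> 'm \<Rightarrow> 'o \<Rightarrow> 'o \<Rightarrow> bool" where
  "arrow C f u v \<longleftrightarrow>
     f \<in> Mor C \<and> u \<in> Ob C \<and> v \<in> Ob C \<and> Dom C f = u \<and> Cod C f = v"

locale category =
  fixes C :: "('o, 'm) category_data"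
  assumes Dom_in_Ob: "f \<in> Mor C \<Longrightarrow> Dom C f \<in> Ob C"
    and Cod_in_Ob: "f \<in> Mor C \<Longrightarrow> Cod C f \<in> Ob C"
    and Ident_arrow: "u \<in> Ob C \<Longrightarrow> arrow C (Ident C u) u u"
    and Comp_arrow: "arrow C f u v \<Longrightarrow> arrow C g v w \<Longrightarrow> arrow C (Comp C g f) u w"
    and Comp_Ident_right: "arrow C f u v \<Longrightarrow> Comp C f (Ident C u) = f"
    and Comp_Ident_left: "arrow C f u v \<Longrightarrow> Comp C (Ident C v) f = f"
    and Comp_assoc: "arrow C f u v \<Longrightarrow> arrow C g v w \<Longrightarrow> arrow C h w x \<Longrightarrow>
      Comp C h (Comp C g f) = Comp C (Comp C h g) f"

definition wellfounded_mors :: "('o, 'm) category_data \<Rightarrow> 'm set \<Rightarrow> bool" where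
  "wellfounded_mors C I \<longleftrightarrow>
     \<not> (\<exists>i :: nat \<Rightarrow> 'm. (\<forall>n. i n \<in> I) \<and> (\<forall>n. Cod C (i n) = Dom C (i (n + 1))))"

text \<open>The square in the shift property is not required to commute.\<close>

definition shift_property :: "('o, 'm) category_data \<Rightarrow> 'm set \<Rightarrow> 'm set \<Rightarrow> bool" where
  "shift_property C J I \<longleftrightarrow>
     (\<forall>u v w. \<forall>j \<in> J. \<forall>i \<in> I. arrow C j v w \<longrightarrow> arrow C i v u \<longrightarrow>
        (\<exists>x \<in> Ob C. \<exists>i' \<in> I. \<exists>j' \<in> J. arrow C i' w x \<and> arrow C j' u x))"

definition seed_order ::
  "('o, 'm) category_data \<Rightarrow> 'm set \<Rightarrow> 'm set \<Rightarrow> 'o \<Rightarrow> 'o \<Rightarrow> bool" where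
  "seed_order C J I u w \<longleftrightarrow>
     (\<exists>x \<in> Ob C. \<exists>j \<in> J. \<exists>i \<in> I. arrow C j u x \<and> arrow C i w x)"

definition wellfounded_on_objects ::
  "('o, 'm) category_data \<Rightarrow> ('o \<Rightarrow> 'o \<Rightarrow> bool) \<Rightarrow> bool" where
  "wellfounded_on_objects C R \<longleftrightarrow>
     \<not> (\<exists>u :: nat \<Rightarrow> 'o. (\<forall>n. u n \<in> Ob C) \<and> (\<forall>n. R (u (n + 1)) (u n)))"

end

theory Submission imports Defs begin

text \<open>Given \<open>u\<^sub>0 > u\<^sub>1 > \<dots>\<close> with witnesses \<open>x\<^sub>n\<close>, so that \<open>u\<^sub>n \<rightarrow> x\<^sub>n\<close> lies in \<open>I\<close> and
  \<open>u\<^sub>n\<^sub>+\<^sub>1 \<rightarrow> x\<^sub>n\<close> in \<open>J\<close>, the shift property applied at each \<open>u\<^sub>n\<^sub>+\<^sub>1\<close> shows \<open>x\<^sub>0 > x\<^sub>1 > \<dots>\<close>.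
  Iterating, the first terms of the successive descending sequences are joined by morphisms
  of \<open>I\<close>, against the wellfoundedness of \<open>I\<close>.\<close>

lemma seed_order_descending_shift:
  assumes shift: "shift_property C J I"
    and desc: "\<And>n. seed_order C J I (u (Suc n)) (u n)"
  obtains x i where "\<And>n. seed_order C J I (x (Suc n)) (x n)" "i \<in> I" "arrow C i (u 0) (x 0)"
proof -
  have "\<forall>n. \<exists>x j i. j \<in> J \<and> i \<in> I \<and> arrow C j (u (Suc n)) x \<and> arrow C i (u n) x"
    using desc unfolding seed_order_def by blast
  then obtain x j i where ji: "\<And>n. j n \<in> J" "\<And>n. i n \<in> I"
      "\<And>n. arrow C (j n) (u (Suc n)) (x n)" "\<And>n. arrow C (i n) (u n) (x n)"
    by metis
  \<comment> \<open>The span \<open>x n\<close> \<leftarrow> \<open>u (Suc n)\<close> \<rightarrow>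
    \<open>x (Suc n)\<close>, with legs \<open>j n\<close> and \<open>i (Suc n)\<close>, is
    completed by shift; the new object witnesses the relation.\<close>
  have "seed_order C J I (x (Suc n)) (x n)" for n
    using shift ji(1)[of n] ji(2)[of "Suc n"] ji(3)[of n] ji(4)[of "Suc n"]
    unfolding shift_property_def seed_order_def by blast
  then show thesis
    using that ji(2,4) by blast
qed

theorem mainTheorem12:
  fixes C :: "('o, 'm) category_data"
    and J I :: "'m set"
  assumes "category C"
    and "J \<subseteq> Mor C"
    and "I \<subseteq> Mor C"
    and "wellfounded_mors C I"
    and "shift_property C J I"
  shows "wellfounded_on_objects C (seed_order C J I)"
proof -
  have False if u: "\<And>n. seed_order C J I (u (Suc n)) (u n)" for u :: "nat \<Rightarrow> 'o"
  proof -
    define P where "P = (\<lambda>v. \<forall>n. seed_order C J I (v (Suc n)) (v n))"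
    define Q where "Q = (\<lambda>(v :: nat \<Rightarrow> 'o) (w :: nat \<Rightarrow> 'o). \<exists>i\<in>I. arrow C i (v 0) (w 0))"
    have step: "\<exists>w. P w \<and> Q v w" if "P v" for v
      using seed_order_descending_shift[OF assms(5), of v] that
      unfolding P_def Q_def by metis
    \<comment> \<open>Each choice is a whole descending sequence, since the next shift needs all its
      terms; only the first terms \<open>v n 0\<close> enter the final chain.\<close>
    have "\<exists>v. \<forall>n. P (v n) \<and> Q (v n) (v (Suc n))"
      by (rule dependent_nat_choice) (use u step in \<open>auto simp: P_def\<close>)
    then obtain v :: "nat \<Rightarrow> nat \<Rightarrow> 'o"
      where "\<And>n. \<exists>i\<in>I. arrow C i (v n 0) (v (Suc n) 0)"
      unfolding Q_def by blast
    then obtain i where "\<And>n. i n \<in> I" "\<And>n. arrow C (i n) (v n 0) (v (Suc n) 0)"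
      by metis
    \<comment> \<open>Consecutive arrows meet at \<open>v (Suc n) 0\<close>, so the
      \<open>i n\<close> form a forbidden chain.\<close>
    then show False
      using assms(4) unfolding wellfounded_mors_def arrow_def by (metis Suc_eq_plus1)
  qed
  then show ?thesis
    unfolding wellfounded_on_objects_def by auto
qed

end
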